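(* Let $n,k$ be positive integers and let $\mathcal{M}_+:\mathbb{R}^{n\times k}\to\mathcal{R}_{\mathcal{M}_+}$, $\mathcal{M}_+(W)=WW^{\top}$, be the symmetric matrix multiplication mapping, where $\mathcal{R}_{\mathcal{M}_+}=\{Z\in\mathbb{R}^{n\times n}: Z\succeq 0,\ \operatorname{rank}(Z)\le\min\{n,k\}\}$ is its range. Then $\mathcal{M}_+$ is open in its range $\mathcal{R}_{\mathcal{M}_+}$.
   Context: A mapping $\mathcal{F}:\mathcal{W}\to\mathcal{Z}$ is open (in $\mathcal{Z}$) if for every open set $U\subseteq\mathcal{W}$ the image $\mathcal{F}(U)$ is relatively open in $\mathcal{Z}$, i.e. for every $u\in\mathcal{F}(U)$ there is $\delta>0$ such that $B_\delta(u)\cap\mathcal{Z}\subseteq\mathcal{F}(U)$. $Z\succeq0$ means that $Z$ is symmetric positive semidefinite. *)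

theory Defs
  imports "HOL-Analysis.Analysis"
begin

definition positive_semidefinite :: "real^'n^'n \<Rightarrow> bool"
  where "positive_semidefinite Z \<longleftrightarrow> transpose Z = Z \<and> (\<forall>x. 0 \<le> x \<bullet> (Z *v x))"

(* An n x k matrix is an element of real^'k^'n: the row index type comes last. *)
definition sym_mult :: "real^'k^'n \<Rightarrow> real^'n^'n"
  where "sym_mult W = W ** transpose W"

(* The dependence on k is made explicit through a type token, TYPE('k). *)
definition sym_mult_range :: "'k::finite itself \<Rightarrow> (real^'n^'n) set"
  where "sym_mult_range (_ :: 'k itself) =
    {Z. positive_semidefinite Z \<and> rank Z \<le> min CARD('n) CARD('k)}"

end

theory Submission
  imports Defs
begin

text \<open>
  Openness of \<open>W \<mapsto> W W\<^sup>T\<close> is obtained from two global properties of the map rather than from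
  a perturbation argument at each \<open>W\<close>, which would have to deal with rank-deficient points.

  The map is closed, because the diagonal of \<open>W W\<^sup>T\<close> consists of the squared lengths of the rows
  of \<open>W\<close>: preimages of bounded sets are bounded, so a convergent sequence of values has a
  convergent subsequence of preimages. Its fibres are orbits of a group of symmetries: the entries
  of \<open>W W\<^sup>T\<close> are the inner products of the rows of \<open>W\<close>, and two families of vectors with the same
  inner products differ by an orthogonal transformation, which is built as a product of
  reflections (\<open>orthogonal_transformation_of_equal_Gram\<close>). A closed surjection with these fibres
  is open (\<open>open_map_of_closed_map_fibres_orbits\<close>): the saturation of an open set \<open>U\<close> is a union of
  preimages of \<open>U\<close> under symmetries, hence open, and its complement has closed image, which is
  the complement of the image of \<open>U\<close>.

  That every positive semidefinite \<open>Z\<close> of rank at most \<open>k\<close> is of the form \<open>W W\<^sup>T\<close> is shown without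
  the spectral theorem. If \<open>c = x \<bullet> Z x > 0\<close>, subtracting the rank-one matrix \<open>(Z x) (Z x)\<^sup>T / c\<close>
  keeps \<open>Z\<close> positive semidefinite and lowers its rank (\<open>positive_semidefinite_peel\<close>). Repeating
  this writes \<open>Z\<close> as a sum of at most \<open>k\<close> matrices \<open>a a\<^sup>T\<close>, and the vectors \<open>a\<close> are the columns of
  \<open>W\<close>.
\<close>

section \<open>Open maps from closed maps and symmetries\<close>

text \<open>
  The set \<open>S\<close> of points that some symmetry of \<open>f\<close> moves into \<open>U\<close> is open and, since symmetries
  act transitively on fibres, equals the full preimage of \<open>f ` U\<close>. So \<open>f ` U\<close> is the complement of
  the closed set \<open>f ` (topspace X - S)\<close>.
\<close>

lemma open_map_of_closed_map_fibres_orbits: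
  assumes closed: "closed_map X Y f"
    and surj: "f ` topspace X = topspace Y"
    and orbit: "\<And>x y. \<lbrakk>x \<in> topspace X; y \<in> topspace X; f x = f y\<rbrakk> \<Longrightarrow>
      \<exists>g. continuous_map X X g \<and> (\<forall>z\<in>topspace X. f (g z) = f z) \<and> g x = y"
  shows "open_map X Y f"
  unfolding open_map_def
proof (intro allI impI)
  fix U assume U: "openin X U"
  define G where "G = {g. continuous_map X X g \<and> (\<forall>z\<in>topspace X. f (g z) = f z)}"
  define S where "S = (\<Union>g\<in>G. {z \<in> topspace X. g z \<in> U})"
  have "openin X S"
    unfolding S_def G_def
    by (intro openin_Union) (auto intro: openin_continuous_map_preimage[OF _ U])
  have S_saturated: "S = {z \<in> topspace X. f z \<in> f ` U}"
  proof (intro equalityI subsetI)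
    fix z assume "z \<in> S"
    then show "z \<in> {z \<in> topspace X. f z \<in> f ` U}"
      unfolding S_def G_def by (fastforce dest: sym)
  next
    fix z assume "z \<in> {z \<in> topspace X. f z \<in> f ` U}"
    then obtain x where z: "z \<in> topspace X" and x: "x \<in> U" "f z = f x" by auto
    moreover have "x \<in> topspace X" using x U openin_subset by blast
    ultimately obtain g where "g \<in> G" "g z = x"
      using orbit[of z x] unfolding G_def by blast
    then show "z \<in> S" using z x unfolding S_def by auto
  qed
  have "closedin Y (f ` (topspace X - S))"
    using closed \<open>openin X S\<close> unfolding closed_map_def by blast
  moreover have "f ` U = topspace Y - f ` (topspace X - S)"
  proof -
    have "f ` (topspace X - S) = f ` topspace X - f ` U"
      unfolding S_saturated by auto
    then show ?thesis
      using surj image_mono[OF openin_subset[OF U], of f] by (simp add: double_diff)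
  qed
  ultimately show "openin Y (f ` U)"
    by (simp add: openin_diff)
qed

text \<open>
  Bounded preimages let one choose a convergent subsequence from any preimages of a convergent
  sequence of values.
\<close>

lemma closed_image_of_bounded_preimages:
  fixes f :: "'a::heine_borel \<Rightarrow> 'b::metric_space"
  assumes cont: "continuous_on UNIV f"
    and bdd: "\<And>B. bounded B \<Longrightarrow> bounded (f -` B)"
    and C: "closed C"
  shows "closed (f ` C)"
  unfolding closed_sequential_limits
proof (intro allI impI)
  fix z l assume "(\<forall>n. z n \<in> f ` C) \<and> z \<longlonglongrightarrow> l"
  then have "\<forall>n. \<exists>x. x \<in> C \<and> f x = z n" and lim: "z \<longlonglongrightarrow> l" by (auto simp: image_iff) metis
  then obtain x where x: "\<And>n. x n \<in> C" "\<And>n. f (x n) = z n" by metis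
  have "bounded (range z)"
    using convergent_imp_bounded lim by blast
  then have "bounded (range x)"
    by (rule bounded_subset[OF bdd]) (use x in auto)
  then obtain y and r :: "nat \<Rightarrow> nat"
    where r: "strict_mono r" and y: "(x \<circ> r) \<longlonglongrightarrow> y"
    using bounded_imp_convergent_subsequence by blast
  have "y \<in> C"
    using closed_sequentially[OF C _ y] x by simp
  moreover have "(\<lambda>n. f ((x \<circ> r) n)) \<longlonglongrightarrow> f y"
    using continuous_on_tendsto_compose[OF cont y] by simp
  then have "(z \<circ> r) \<longlonglongrightarrow> f y"
    using x by (simp add: o_def)
  then have "f y = l"
    using LIMSEQ_subseq_LIMSEQ[OF lim r] LIMSEQ_unique by blast
  ultimately show "l \<in> f ` C" by blast
qed

section \<open>Families of vectors with the same Gram matrix\<close>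

text \<open>
  The reflection in the hyperplane orthogonal to \<open>d = u - w\<close>. Equality of norms says that \<open>u\<close> and
  \<open>w\<close> are mirror images, and the condition \<open>x \<bullet> u = x \<bullet> w\<close> says that \<open>x\<close> lies on the mirror. If
  \<open>u = w\<close>, division by zero makes the formula the identity, as required.
\<close>

lemma reflection_between_equal_norms:
  fixes u w :: "'a::real_inner"
  assumes "norm u = norm w"
  obtains f where "orthogonal_transformation f" "f u = w"
    "\<And>x. x \<bullet> u = x \<bullet> w \<Longrightarrow> f x = x"
proof
  define d where "d = u - w"
  define f where "f = (\<lambda>x. x - (2 * (x \<bullet> d) / (d \<bullet> d)) *\<^sub>R d)"
  have "linear f"
    unfolding f_def
    by (rule linearI) (auto simp: algebra_simps add_divide_distrib)
  moreover have "f x \<bullet> f y = x \<bullet> y" for x y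
  proof (cases "d = 0")
    case False
    define a where "a = (\<lambda>z. 2 * (z \<bullet> d) / (d \<bullet> d))"
    have a: "z \<bullet> d = a z * (d \<bullet> d) / 2" "d \<bullet> z = a z * (d \<bullet> d) / 2" for z
      using False by (simp_all add: a_def inner_commute)
    have f_eq: "f z = z - a z *\<^sub>R d" for z
      by (simp add: f_def a_def)
    have "f x \<bullet> f y = x \<bullet> y - a y * (x \<bullet> d) - a x * (d \<bullet> y) + a x * a y * (d \<bullet> d)"
      by (simp add: f_eq inner_diff_left inner_diff_right algebra_simps)
    also have "\<dots> = x \<bullet> y"
      by (simp only: a(1)[of x] a(2)[of y]) simp
    finally show ?thesis .
  qed (simp add: f_def)
  ultimately show "orthogonal_transformation f"
    unfolding orthogonal_transformation_def by blast
  show "f x = x" if "x \<bullet> u = x \<bullet> w" for x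
    using that unfolding f_def d_def by (simp add: inner_diff_right)
  show "f u = w"
  proof (cases "d = 0")
    case False
    have "u \<bullet> u = w \<bullet> w"
      using assms by (metis dot_square_norm)
    then have "2 * (u \<bullet> d) = d \<bullet> d"
      unfolding d_def by (simp add: algebra_simps inner_commute)
    then show ?thesis
      using False unfolding f_def by (simp add: d_def)
  qed (simp add: f_def d_def)
qed

text \<open>
  The vectors are matched one at a time. Once \<open>f\<close> takes \<open>v i\<close> to \<open>w i\<close> for \<open>i \<in> I\<close>, equality of
  inner products places these \<open>w i\<close> on the mirror of the reflection that takes \<open>f (v j)\<close> to \<open>w j\<close>.
  Composing \<open>f\<close> with that reflection therefore does not disturb them.
\<close>

lemma orthogonal_transformation_of_equal_Gram:
  fixes v w :: "'i \<Rightarrow> 'a::real_inner"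
  assumes "finite I" and gram: "\<And>i j. \<lbrakk>i \<in> I; j \<in> I\<rbrakk> \<Longrightarrow> v i \<bullet> v j = w i \<bullet> w j"
  shows "\<exists>f. orthogonal_transformation f \<and> (\<forall>i\<in>I. f (v i) = w i)"
  using assms
proof (induction I)
  case empty
  show ?case using orthogonal_transformation_id by blast
next
  case (insert j I)
  then obtain f where f: "orthogonal_transformation f" and fv: "\<And>i. i \<in> I \<Longrightarrow> f (v i) = w i"
    by (metis insertCI)
  have f_inner: "f x \<bullet> f y = x \<bullet> y" for x y
    using f unfolding orthogonal_transformation_def by blast
  have "norm (f (v j)) = norm (w j)"
    using f_inner insert.prems[of j j] by (simp add: norm_eq_sqrt_inner)
  then obtain g where g: "orthogonal_transformation g" "g (f (v j)) = w j"
    and g_fix: "\<And>x. x \<bullet> f (v j) = x \<bullet> w j \<Longrightarrow> g x = x"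
    using reflection_between_equal_norms by blast
  have "g (f (v i)) = w i" if "i \<in> I" for i
  proof -
    have "w i \<bullet> f (v j) = w i \<bullet> w j"
      using that fv f_inner[of "v i" "v j"] insert.prems[of i j] by simp
    then show ?thesis using g_fix fv that by simp
  qed
  then show ?case
    using g orthogonal_transformation_compose[OF g(1) f]
    by (intro exI[of _ "g \<circ> f"]) (simp add: o_def)
qed

section \<open>Positive semidefinite matrices as sums of rank-one matrices\<close>

lemma symmetric_inner_commute:
  fixes Z :: "real^'n^'n"
  assumes "transpose Z = Z"
  shows "x \<bullet> (Z *v y) = y \<bullet> (Z *v x)"
proof -
  have "x \<bullet> (Z *v y) = (transpose Z *v x) \<bullet> y"
    by (simp add: dot_lmul_matrix transpose_matrix_vector)
  then show ?thesis
    by (simp add: assms inner_commute)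
qed

text \<open>
  If the quadratic form vanished everywhere, so would the symmetric bilinear form, by polarisation.
\<close>

lemma positive_semidefinite_nonzero:
  fixes Z :: "real^'n^'n"
  assumes Z: "positive_semidefinite Z" and "Z \<noteq> 0"
  obtains x where "0 < x \<bullet> (Z *v x)"
proof (rule ccontr)
  assume "\<not> thesis"
  then have zero: "x \<bullet> (Z *v x) = 0" for x
    using Z that unfolding positive_semidefinite_def by (metis order_le_less)
  have "x \<bullet> (Z *v y) = 0" for x y
    using zero[of "x + y"] zero[of x] zero[of y] symmetric_inner_commute[of Z x y] Z
    unfolding positive_semidefinite_def
    by (simp add: matrix_vector_right_distrib inner_add_left inner_add_right)
  then have "Z *v y = 0" for y
    by (metis inner_eq_zero_iff)
  then have "Z = 0"
    by (simp add: matrix_eq)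
  then show False using \<open>Z \<noteq> 0\<close> by simp
qed

text \<open>
  With \<open>u = Z x\<close> and \<open>c = x \<bullet> u\<close>, the value at \<open>y\<close> of the form of \<open>Z'\<close> is that of \<open>Z\<close> at
  \<open>y - t x\<close>, where \<open>t = (y \<bullet> u) / c\<close> makes \<open>y - t x\<close> orthogonal to \<open>x\<close> for the form of \<open>Z\<close>; hence
  it is nonnegative. The rank drops since the range of \<open>Z'\<close> is contained in that of \<open>Z\<close> and, as
  \<open>Z' x = 0\<close>, is orthogonal to \<open>x\<close>, whereas \<open>u\<close> lies in the range of \<open>Z\<close> and \<open>x \<bullet> u > 0\<close>.
\<close>

lemma positive_semidefinite_peel:
  fixes Z :: "real^'n^'n"
  assumes Z: "positive_semidefinite Z" and c: "0 < x \<bullet> (Z *v x)"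
  defines "Z' \<equiv> (\<chi> i j. Z$i$j - (Z *v x)$i * (Z *v x)$j / (x \<bullet> (Z *v x)))"
  shows "positive_semidefinite Z'" and "rank Z' < rank Z"
proof -
  define u where "u = Z *v x"
  define c where "c = x \<bullet> u"
  have "c > 0" using c by (simp add: c_def u_def)
  have sym: "transpose Z = Z" and pos: "\<And>y. 0 \<le> y \<bullet> (Z *v y)"
    using Z unfolding positive_semidefinite_def by auto
  have sym_entry: "Z$i$j = Z$j$i" for i j
    by (metis sym transpose_def vec_lambda_beta)
  have mult: "Z' *v y = Z *v y - ((y \<bullet> u) / c) *\<^sub>R u" for y
    unfolding Z'_def u_def[symmetric] c_def[symmetric]
    by (simp add: vec_eq_iff matrix_vector_mult_def inner_vec_def left_diff_distrib
        sum_subtractf sum_divide_distrib sum_distrib_left sum_distrib_right ac_simps)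
      (simp add: algebra_simps sum_subtractf)
  have sym': "transpose Z' = Z'"
    unfolding Z'_def by (simp add: vec_eq_iff transpose_def sym_entry mult.commute)
  have "0 \<le> y \<bullet> (Z' *v y)" for y
  proof -
    define t where "t = (y \<bullet> u) / c"
    have tc: "y \<bullet> u = t * c" using \<open>c > 0\<close> by (simp add: t_def)
    have xy: "x \<bullet> (Z *v y) = t * c"
      using symmetric_inner_commute[OF sym, of x y] tc by (simp add: u_def)
    have "0 \<le> (y - t *\<^sub>R x) \<bullet> (Z *v (y - t *\<^sub>R x))" by (rule pos)
    also have "\<dots> = y \<bullet> (Z *v y) - t * (t * c)"
      using tc xy c_def
      by (simp add: matrix_vector_mult_diff_distrib matrix_vector_mult_scaleR u_def[symmetric]
          inner_diff_left inner_diff_right)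
    also have "\<dots> = y \<bullet> (Z' *v y)"
      using tc by (simp add: mult t_def[symmetric] inner_diff_right)
    finally show ?thesis .
  qed
  with sym' show "positive_semidefinite Z'"
    unfolding positive_semidefinite_def by blast
  let ?R = "range ((*v) Z)" and ?R' = "range ((*v) Z')"
  have subspace: "subspace (range ((*v) A))" for A :: "real^'n^'n"
    by (intro linear_subspace_image matrix_vector_mul_linear subspace_UNIV)
  have sub: "?R' \<subseteq> ?R"
  proof clarify
    fix y
    have "Z' *v y = Z *v (y - ((y \<bullet> u) / c) *\<^sub>R x)"
      by (simp add: mult u_def matrix_vector_mult_diff_distrib matrix_vector_mult_scaleR)
    then show "Z' *v y \<in> ?R" by simp
  qed
  have "Z' *v x = 0"
    using \<open>c > 0\<close> by (simp add: mult u_def[symmetric] c_def[symmetric])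
  then have "x \<bullet> z = 0" if "z \<in> ?R'" for z
    using that symmetric_inner_commute[OF sym', of x] by auto
  then have "u \<notin> ?R'" using \<open>c > 0\<close> c_def by force
  moreover have "u \<in> ?R" by (simp add: u_def)
  ultimately have "\<not> dim ?R \<le> dim ?R'"
    using subspace_dim_equal[OF subspace subspace sub] by blast
  then show "rank Z' < rank Z"
    by (simp add: rank_dim_range)
qed

text \<open>
  The index set \<open>S\<close> is any set with enough room for the rank, so that it can be taken to be the
  set of columns of the factor \<open>W\<close>; once the matrix is used up, the remaining vectors are zero.
\<close>

lemma positive_semidefinite_sum_rank_one:
  fixes Z :: "real^'n^'n"
  assumes "finite S" "positive_semidefinite Z" "rank Z \<le> card S"
  shows "\<exists>a :: 's \<Rightarrow> real^'n. \<forall>i j. Z$i$j = (\<Sum>s\<in>S. a s $ i * a s $ j)"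
  using assms
proof (induction S arbitrary: Z)
  case empty
  then show ?case by (simp add: rank_eq_0)
next
  case (insert s S)
  show ?case
  proof (cases "Z = 0")
    case True
    then show ?thesis by (intro exI[of _ "\<lambda>_. 0"]) simp
  next
    case False
    then obtain x where c: "0 < x \<bullet> (Z *v x)"
      using positive_semidefinite_nonzero insert.prems by blast
    define c where "c = x \<bullet> (Z *v x)"
    define u where "u = Z *v x"
    define Z' where "Z' = (\<chi> i j. Z$i$j - u$i * u$j / c)"
    have "positive_semidefinite Z'" "rank Z' < rank Z"
      using positive_semidefinite_peel[OF insert.prems(1) c] by (simp_all add: Z'_def u_def c_def)
    then obtain a :: "'s \<Rightarrow> real^'n" where a: "\<And>i j. Z'$i$j = (\<Sum>s\<in>S. a s $ i * a s $ j)"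
      using insert by fastforce
    define b where "b = a(s := (1 / sqrt c) *\<^sub>R u)"
    have "Z$i$j = (\<Sum>t\<in>insert s S. b t $ i * b t $ j)" for i j
    proof -
      have "(\<Sum>t\<in>S. b t $ i * b t $ j) = Z'$i$j"
        unfolding a b_def using insert.hyps by (intro sum.cong) auto
      moreover have "b s $ i * b s $ j = u$i * u$j / c"
        using c by (simp add: b_def c_def)
      ultimately show ?thesis
        using insert.hyps by (simp add: Z'_def)
    qed
    then show ?thesis by blast
  qed
qed

section \<open>The symmetric multiplication map\<close>

lemma sym_mult_nth: "sym_mult W $ i $ j = W $ i \<bullet> W $ j"
  by (simp add: sym_mult_def matrix_matrix_mult_def transpose_def inner_vec_def)

lemma range_sym_mult: "range (sym_mult :: real^'k^'n \<Rightarrow> real^'n^'n) = sym_mult_range TYPE('k)"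
proof (intro equalityI subsetI)
  fix Z assume "Z \<in> range (sym_mult :: real^'k^'n \<Rightarrow> real^'n^'n)"
  then obtain W :: "real^'k^'n" where Z: "Z = W ** transpose W"
    by (auto simp: sym_mult_def)
  have "x \<bullet> (Z *v x) = (transpose W *v x) \<bullet> (transpose W *v x)" for x
    by (simp add: Z matrix_vector_mul_assoc[symmetric] dot_lmul_matrix[symmetric])
  moreover have "transpose Z = Z"
    by (simp add: Z matrix_transpose_mul)
  moreover have "rank Z \<le> min CARD('n) CARD('k)"
    using rank_mul_le_left[of W "transpose W"] rank_bound[of W] by (simp add: Z)
  ultimately show "Z \<in> sym_mult_range TYPE('k)"
    by (simp add: sym_mult_range_def positive_semidefinite_def)
next
  fix Z :: "real^'n^'n" assume "Z \<in> sym_mult_range TYPE('k)"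
  then obtain a :: "'k \<Rightarrow> real^'n" where "\<And>i j. Z$i$j = (\<Sum>s\<in>UNIV. a s $ i * a s $ j)"
    using positive_semidefinite_sum_rank_one[of "UNIV :: 'k set" Z]
    by (auto simp: sym_mult_range_def)
  then have "Z = sym_mult (\<chi> i s. a s $ i)"
    by (simp add: vec_eq_iff sym_mult_nth inner_vec_def)
  then show "Z \<in> range (sym_mult :: real^'k^'n \<Rightarrow> real^'n^'n)" by blast
qed

lemma continuous_on_sym_mult:
  fixes A :: "(real^'k^'n) set"
  shows "continuous_on A sym_mult"
proof -
  have "sym_mult = (\<lambda>W :: real^'k^'n. \<chi> i j. W $ i \<bullet> W $ j)"
    by (simp add: fun_eq_iff vec_eq_iff sym_mult_nth)
  moreover have "continuous_on A (\<lambda>W. \<chi> i j. W $ i \<bullet> W $ j)"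
    by (intro continuous_intros)
  ultimately show ?thesis by metis
qed

lemma bounded_vimage_sym_mult:
  fixes B :: "(real^'n^'n) set"
  assumes "bounded B"
  shows "bounded ((sym_mult :: real^'k^'n \<Rightarrow> real^'n^'n) -` B)"
proof -
  obtain b where b: "\<And>Z. Z \<in> B \<Longrightarrow> norm Z \<le> b"
    using assms bounded_iff by blast
  have "norm W \<le> (\<Sum>i\<in>(UNIV::'n set). sqrt b)" if "sym_mult W \<in> B" for W :: "real^'k^'n"
  proof -
    have "norm (W $ i) \<le> sqrt b" for i
    proof -
      have "W $ i \<bullet> W $ i \<le> norm (sym_mult W)"
        using component_le_norm_cart[of "sym_mult W $ i" i]
          Finite_Cartesian_Product.norm_nth_le[of "sym_mult W" i]
        by (simp add: sym_mult_nth)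
      also have "\<dots> \<le> b" using b that by blast
      finally show ?thesis by (simp add: norm_eq_sqrt_inner)
    qed
    then have "(\<Sum>i\<in>UNIV. norm (W $ i)) \<le> (\<Sum>i\<in>(UNIV::'n set). sqrt b)"
      by (intro sum_mono)
    moreover have "norm W \<le> (\<Sum>i\<in>UNIV. norm (W $ i))"
      unfolding norm_vec_def[of W] by (intro L2_set_le_sum norm_ge_zero)
    ultimately show ?thesis by linarith
  qed
  then show ?thesis
    by (intro boundedI[of _ "\<Sum>i\<in>(UNIV::'n set). sqrt b"]) auto
qed

text \<open>
  The symmetry applies one orthogonal transformation to all rows, that is, it multiplies by an
  orthogonal matrix on the right.
\<close>

lemma sym_mult_fibre_orbit:
  fixes V W :: "real^'k^'n"
  assumes "sym_mult V = sym_mult W"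
  shows "\<exists>g. continuous_on UNIV g \<and> (\<forall>X. sym_mult (g X) = sym_mult X) \<and> g V = W"
proof -
  have "V $ i \<bullet> V $ j = W $ i \<bullet> W $ j" for i j
    using assms by (metis sym_mult_nth)
  then obtain f where f: "orthogonal_transformation f" and fV: "\<And>i. f (V $ i) = W $ i"
    using orthogonal_transformation_of_equal_Gram[of UNIV "($) V" "($) W"] by auto
  define g :: "real^'k^'n \<Rightarrow> real^'k^'n" where "g = (\<lambda>X. \<chi> i. f (X $ i))"
  have "linear f"
    using f by (rule orthogonal_transformation_linear)
  then have "continuous_on UNIV g"
    unfolding g_def
    by (intro continuous_on_vec_lambda linear_continuous_on_compose[OF _ \<open>linear f\<close>]
        continuous_on_component continuous_on_id)
  moreover have "sym_mult (g X) = sym_mult X" for X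
    using f by (simp add: vec_eq_iff sym_mult_nth g_def orthogonal_transformation_def)
  moreover have "g V = W"
    by (simp add: vec_eq_iff g_def fV)
  ultimately show ?thesis by blast
qed

theorem theorem9:
  shows "range (sym_mult :: real^'k^'n \<Rightarrow> real^'n^'n) = sym_mult_range TYPE('k) \<and>
    open_map euclidean (top_of_set (sym_mult_range TYPE('k)))
      (sym_mult :: real^'k^'n \<Rightarrow> real^'n^'n)"
proof
  let ?f = "sym_mult :: real^'k^'n \<Rightarrow> real^'n^'n"
  show range_eq: "range ?f = sym_mult_range TYPE('k)"
    by (rule range_sym_mult)
  show "open_map euclidean (top_of_set (sym_mult_range TYPE('k))) ?f"
  proof (rule open_map_of_closed_map_fibres_orbits)
    have "closedin (top_of_set (sym_mult_range TYPE('k))) (?f ` C)" if "closed C" for C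
      using closed_image_of_bounded_preimages[OF continuous_on_sym_mult bounded_vimage_sym_mult that]
      by (intro closed_subset) (use range_eq in auto)
    then show "closed_map euclidean (top_of_set (sym_mult_range TYPE('k))) ?f"
      unfolding closed_map_def by simp
    show "?f ` topspace euclidean = topspace (top_of_set (sym_mult_range TYPE('k)))"
      by (simp add: range_eq)
    show "\<exists>g. continuous_map euclidean euclidean g \<and>
        (\<forall>Z\<in>topspace euclidean. ?f (g Z) = ?f Z) \<and> g V = W" if "?f V = ?f W" for V W
      using sym_mult_fibre_orbit[OF that] by simp
  qed
qed

end
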